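(* Let $r\ge 1$, let $p_1,\dots,p_r\ge 5$ be distinct primes and $P=p_1\cdots p_r$. With the notation of the context, for every positive integer $n$, $$\mathcal C_P(n)=\sum_{\boldsymbol\alpha\in\{0,1,2\}^r} W_{\boldsymbol\alpha}(n)\,L\bigl(m(n),Q_{\boldsymbol\alpha},\eta_{\boldsymbol\alpha}(n)\bigr).$$ Moreover, $$g_P(2n)=\begin{cases}\mathcal C_P(n), & \delta_3(n)=0,\\[4pt] \dfrac{\mathcal C_P(n)+D_P(n)}{2}, & \delta_3(n)\in\{1,2\}.\end{cases}$$
   Context: $M=6P$. $\mathbf 1_{\{\cdot\}}$ denotes the indicator of a condition. For $q\in\mathbb Z_{>0}$ and $x\in\mathbb Z$, $\delta_q(x)=x-q\lfloor x/q\rfloor\in\{0,\dots,q-1\}$ (so $\delta_1\equiv 0$). $g_P(2n)$ is the number of pairs $(h,k)\in\mathbb Z_{>0}^2$ with $h+k=2n$, $h\le k$, $\gcd(h,M)=\gcd(k,M)=1$. For a prime $p\ge5$: $a(p)=\frac{p\,\delta_6(p)-1}{6}$ and $b(p)=p-1-a(p)$ (both are integers in $\{0,\dots,p-1\}$). Write $a_i=a(p_i)$, $b_i=b(p_i)$. $m(n)=\frac n3-1$ if $\delta_3(n)=0$; $m(n)=\frac{n-1}{3}$ if $\delta_3(n)=1$; $m(n)=\frac{n-5}{3}$ if $\delta_3(n)=2$. $\mathcal Z(n)=\{z\in\mathbb Z: 0\le z\le m(n)\}$ (empty for $n=2$, where $m(2)=-1$). For $z\in\mathcal Z(n)$: if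 $\delta_3(n)=0$, $H_z(n)=6z+1$, $K_z(n)=6(m(n)-z)+5$; if $\delta_3(n)=1$, $H_z(n)=6z+1$, $K_z(n)=6(m(n)-z)+1$; if $\delta_3(n)=2$, $H_z(n)=6z+5$, $K_z(n)=6(m(n)-z)+5$. $\mathcal C_P(n)=\#\{z\in\mathcal Z(n):\gcd(H_z(n)K_z(n),P)=1\}$ and $D_P(n)=\mathbf 1_{\{\gcd(n,6P)=1\}}$. For $1\le i\le r$ define $x_i(n),y_i(n)\in\{0,\dots,p_i-1\}$: if $\delta_3(n)=0$, $x_i(n)=a_i$, $y_i(n)=\delta_{p_i}(m(n)-b_i)$; if $\delta_3(n)=1$, $x_i(n)=a_i$, $y_i(n)=\delta_{p_i}(m(n)-a_i)$; if $\delta_3(n)=2$, $x_i(n)=b_i$, $y_i(n)=\delta_{p_i}(m(n)-b_i)$. $\varepsilon_i(n)=\mathbf 1_{\{\delta_{p_i}(n)=0\}}$. Weights: $w_{i,0}(n)=1$, $w_{i,1}(n)=-(1-\varepsilon_i(n))$, $w_{i,2}(n)=-1$. For $\boldsymbol\alpha=(\alpha_1,\dots,\alpha_r)\in\{0,1,2\}^r$: $W_{\boldsymbol\alpha}(n)=\prod_{i=1}^r w_{i,\alpha_i}(n)$, $I_{\boldsymbol\alpha}=\{i:\alpha_i\ne0\}$, $Q_{\boldsymbol\alpha}=\prod_{i\in I_{\boldsymbol\alpha}}p_i$ (empty product $=1$). Put $s_{i,1}(n)=x_i(n)$, $s_{i,2}(n)=y_i(n)$. If $I_{\boldsymbol\alpha}=\varnothing$,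 $\eta_{\boldsymbol\alpha}(n)=0$; otherwise $\eta_{\boldsymbol\alpha}(n)$ is the unique element of $\{0,\dots,Q_{\boldsymbol\alpha}-1\}$ with $\delta_{p_i}(\eta_{\boldsymbol\alpha}(n))=s_{i,\alpha_i}(n)$ for all $i\in I_{\boldsymbol\alpha}$ (Chinese remainder theorem). For integers $m\ge-1$, $q\ge1$, $0\le a\le q-1$: $L(m,q,a)=\#\{z\in\mathbb Z:0\le z\le m,\ \delta_q(z)=a\}$, which equals $1+\left\lfloor\frac{m-a}{q}\right\rfloor$. *)

theory Defs
  imports "HOL-Number_Theory.Number_Theory" "HOL-Library.FuncSet"
begin

text \<open>Integers are modelled by the type \<^typ>\<open>int\<close> throughout.  A quantity carrying an index
  \<open>i\<close> that depends on \<open>i\<close> only through the prime \<open>p\<^sub>i\<close> (such as \<open>x\<^sub>i(n)\<close> or \<open>w\<^sub>i\<^sub>,\<^sub>j(n)\<close>) is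
  a function of that prime, called \<open>q\<close>.  Case distinctions on \<open>\<delta>\<^sub>3(n)\<close> end in an \<open>else\<close> branch that
  stands for \<open>\<delta>\<^sub>3(n) = 2\<close>.\<close>

definition delta :: "int \<Rightarrow> int \<Rightarrow> int" where
  "delta q x = x - q * \<lfloor>real_of_int x / real_of_int q\<rfloor>"

lemma delta_eq_mod: "delta q x = x mod q"
  by (simp add: delta_def floor_divide_of_int_eq minus_mult_div_eq_mod)

text \<open>Here \<open>M = 6P\<close>.\<close>

definition g_count :: "int \<Rightarrow> int \<Rightarrow> nat" where
  "g_count P N = card {(h, k). 0 < h \<and> 0 < k \<and> h + k = N \<and> h \<le> k \<and>
     gcd h (6 * P) = 1 \<and> gcd k (6 * P) = 1}"

definition a_res :: "int \<Rightarrow> int" where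
  "a_res q = (q * delta 6 q - 1) div 6"

definition b_res :: "int \<Rightarrow> int" where
  "b_res q = q - 1 - a_res q"

text \<open>The integer division in \<open>a_res\<close> is exact for the primes in question.\<close>

lemma a_res_exact:
  fixes q :: int
  assumes "prime q" "q \<ge> 5"
  shows "6 * a_res q = q * delta 6 q - 1"
proof -
  have "\<not> 2 dvd q" "\<not> 3 dvd q"
    using assms primes_dvd_imp_eq[of 2 q] primes_dvd_imp_eq[of 3 q] by auto
  then have "q mod 6 = 1 \<or> q mod 6 = 5"
    by presburger
  then consider "q mod 6 = 1" | "q mod 6 = 5"
    by blast
  then show ?thesis
  proof cases
    case 1
    then obtain k where "q * 1 - 1 = 6 * k"
      by (metis add_diff_cancel_right' mult.right_neutral mult_div_mod_eq)
    with 1 show ?thesis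
      by (metis a_res_def delta_eq_mod nonzero_mult_div_cancel_left zero_neq_numeral)
  next
    case 2
    then obtain k where "q = 6 * k + 5"
      by (metis mult_div_mod_eq)
    then have "q * 5 - 1 = 6 * (5 * k + 4)"
      by simp
    with 2 show ?thesis
      by (metis a_res_def delta_eq_mod nonzero_mult_div_cancel_left zero_neq_numeral)
  qed
qed

definition m_of :: "int \<Rightarrow> int" where
  "m_of n = (if delta 3 n = 0 then n div 3 - 1
             else if delta 3 n = 1 then (n - 1) div 3
             else (n - 5) div 3)"

lemma m_of_exact:
  "real_of_int (m_of n) =
    (if delta 3 n = 0 then real_of_int n / 3 - 1
     else if delta 3 n = 1 then (real_of_int n - 1) / 3
     else (real_of_int n - 5) / 3)"
proof -
  have n: "n = 3 * (n div 3) + n mod 3"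
    by simp
  consider "n mod 3 = 0" | "n mod 3 = 1" | "n mod 3 = 2"
    by linarith
  then show ?thesis
  proof cases
    case 1
    with n obtain k where "n = 3 * k" by auto
    then show ?thesis
      by (simp add: m_of_def delta_eq_mod)
  next
    case 2
    with n obtain k where "n = 3 * k + 1" by auto
    then show ?thesis
      by (simp add: m_of_def delta_eq_mod)
  next
    case 3
    with n obtain k where k: "n = 3 * k + 2" by auto
    then have "(n - 5) div 3 = k - 1"
      by simp
    with 3 k show ?thesis
      by (simp add: m_of_def delta_eq_mod)
  qed
qed

definition Z_set :: "int \<Rightarrow> int set" where
  "Z_set n = {z. 0 \<le> z \<and> z \<le> m_of n}"

definition H_of :: "int \<Rightarrow> int \<Rightarrow> int" where
  "H_of n z = (if delta 3 n = 0 then 6 * z + 1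
               else if delta 3 n = 1 then 6 * z + 1
               else 6 * z + 5)"

definition K_of :: "int \<Rightarrow> int \<Rightarrow> int" where
  "K_of n z = (if delta 3 n = 0 then 6 * (m_of n - z) + 5
               else if delta 3 n = 1 then 6 * (m_of n - z) + 1
               else 6 * (m_of n - z) + 5)"

definition C_count :: "int \<Rightarrow> int \<Rightarrow> nat" where
  "C_count P n = card {z \<in> Z_set n. gcd (H_of n z * K_of n z) P = 1}"

definition D_ind :: "int \<Rightarrow> int \<Rightarrow> nat" where
  "D_ind P n = of_bool (gcd n (6 * P) = 1)"

definition x_res :: "int \<Rightarrow> int \<Rightarrow> int" where
  "x_res q n = (if delta 3 n = 0 then a_res q
                else if delta 3 n = 1 then a_res q
                else b_res q)"

definition y_res :: "int \<Rightarrow> int \<Rightarrow> int" where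
  "y_res q n = (if delta 3 n = 0 then delta q (m_of n - b_res q)
                else if delta 3 n = 1 then delta q (m_of n - a_res q)
                else delta q (m_of n - b_res q))"

definition eps :: "int \<Rightarrow> int \<Rightarrow> int" where
  "eps q n = of_bool (delta q n = 0)"

text \<open>The second argument of \<open>w\<close> and \<open>s_res\<close> is an entry of \<open>\<alpha>\<close>: it ranges over
  \<open>{0, 1, 2}\<close> for \<open>w\<close> and over \<open>{1, 2}\<close> for \<open>s_res\<close>.\<close>

definition w :: "int \<Rightarrow> nat \<Rightarrow> int \<Rightarrow> int" where
  "w q j n = (if j = 0 then 1 else if j = 1 then - (1 - eps q n) else - 1)"

definition s_res :: "int \<Rightarrow> nat \<Rightarrow> int \<Rightarrow> int" where
  "s_res q j n = (if j = 1 then x_res q n else y_res q n)"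

definition W :: "nat \<Rightarrow> (nat \<Rightarrow> int) \<Rightarrow> (nat \<Rightarrow> nat) \<Rightarrow> int \<Rightarrow> int" where
  "W r p \<alpha> n = (\<Prod>i=1..r. w (p i) (\<alpha> i) n)"

definition I_set :: "nat \<Rightarrow> (nat \<Rightarrow> nat) \<Rightarrow> nat set" where
  "I_set r \<alpha> = {i \<in> {1..r}. \<alpha> i \<noteq> 0}"

definition Q :: "nat \<Rightarrow> (nat \<Rightarrow> int) \<Rightarrow> (nat \<Rightarrow> nat) \<Rightarrow> int" where
  "Q r p \<alpha> = (\<Prod>i\<in>I_set r \<alpha>. p i)"

definition eta :: "nat \<Rightarrow> (nat \<Rightarrow> int) \<Rightarrow> (nat \<Rightarrow> nat) \<Rightarrow> int \<Rightarrow> int" where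
  "eta r p \<alpha> n = (if I_set r \<alpha> = {} then 0
     else (THE e. e \<in> {0..Q r p \<alpha> - 1} \<and>
                  (\<forall>i\<in>I_set r \<alpha>. delta (p i) e = s_res (p i) (\<alpha> i) n)))"

definition L :: "int \<Rightarrow> int \<Rightarrow> int \<Rightarrow> nat" where
  "L m q a = card {z. 0 \<le> z \<and> z \<le> m \<and> delta q z = a}"

lemma L_eq_floor:
  assumes "m \<ge> - 1" "q \<ge> 1" "0 \<le> a" "a \<le> q - 1"
  shows "int (L m q a) = 1 + \<lfloor>real_of_int (m - a) / real_of_int q\<rfloor>"
proof -
  let ?t = "(m - a) div q"
  have "{z. 0 \<le> z \<and> z \<le> m \<and> delta q z = a} = (\<lambda>t. a + q * t) ` {0..?t}"
  proof (intro equalityI subsetI)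
    fix z assume "z \<in> {z. 0 \<le> z \<and> z \<le> m \<and> delta q z = a}"
    then have z: "0 \<le> z" "z \<le> m" "z mod q = a"
      by (auto simp: delta_eq_mod)
    then have e: "z = a + q * (z div q)"
      by (metis mod_mult_div_eq)
    have "z div q = (z - a) div q"
      using e assms by (metis add_diff_cancel_left' nonzero_mult_div_cancel_left not_one_le_zero)
    also have "\<dots> \<le> ?t"
      using z assms by (intro zdiv_mono1) auto
    finally have "z div q \<in> {0..?t}"
      using z assms by (simp add: pos_imp_zdiv_nonneg_iff)
    with e show "z \<in> (\<lambda>t. a + q * t) ` {0..?t}"
      by blast
  next
    fix z assume "z \<in> (\<lambda>t. a + q * t) ` {0..?t}"
    then obtain t where t: "z = a + q * t" "0 \<le> t" "t \<le> ?t"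
      by (meson imageE atLeastAtMost_iff)
    have "q * t \<le> q * ?t"
      using t assms by (intro mult_left_mono) auto
    also have "\<dots> \<le> m - a"
      using assms by (smt (verit) mult_div_mod_eq pos_mod_sign)
    finally show "z \<in> {z. 0 \<le> z \<and> z \<le> m \<and> delta q z = a}"
      using t assms by (auto simp: delta_eq_mod)
  qed
  moreover have "inj_on (\<lambda>t. a + q * t) {0..?t}"
    using assms by (auto simp: inj_on_def)
  moreover have "- 1 \<le> ?t"
    using assms zdiv_mono1[of "- q" "m - a" q] nonzero_mult_div_cancel_right[of q "- 1"] by simp
  ultimately show ?thesis
    by (simp add: L_def card_image floor_divide_of_int_eq flip: of_int_diff)
qed

end

theory Submission
  imports Defs
begin

text \<open>For each prime \<open>q = p\<^sub>i\<close> the residues \<open>x\<^sub>i\<close> and \<open>y\<^sub>i\<close> are exactly those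
  of the \<open>z\<close> for which \<open>q\<close> divides \<open>H\<^sub>z\<close> respectively \<open>K\<^sub>z\<close>.  As \<open>H\<^sub>z + K\<^sub>z = 2n\<close>,
  the two divisibilities are equivalent if \<open>q\<close> divides \<open>n\<close> and exclude each other otherwise, so the
  indicator of \<open>q \<nmid> H\<^sub>z K\<^sub>z\<close> is the sum of the weights \<open>w\<^sub>i\<^sub>,\<^sub>j\<close> over those \<open>j\<close> that are \<open>0\<close> or whose
  residue class contains \<open>z\<close>.  Multiplying over all primes, expanding and summing over \<open>z\<close> gives
  the formula for \<open>\<C>\<^sub>P\<close>.

  For the Goldbach count, let \<open>S\<close> be the set of \<open>0 < h < 2n\<close> with \<open>h\<close> and \<open>2n - h\<close> both coprime to
  \<open>6P\<close>.  The reflection \<open>h \<mapsto> 2n - h\<close> has at most the fixed point \<open>n\<close>, hence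
  \<open>2 g\<^sub>P(2n) = |S| + D\<^sub>P(n)\<close>.  On the other hand \<open>z \<mapsto> H\<^sub>z\<close> identifies the set counted by \<open>\<C>\<^sub>P(n)\<close>
  with the part of \<open>S\<close> in one residue class modulo \<open>6\<close>; this is all of \<open>S\<close> if \<open>3 \<nmid> n\<close>, and half of
  \<open>S\<close> otherwise, as reflection exchanges the classes \<open>1\<close> and \<open>5\<close>.\<close>

section \<open>Chinese remainders and coprimality to 6\<close>

lemma chinese_remainder_int:
  fixes m :: "'a \<Rightarrow> int"
  assumes "finite A" "\<forall>i\<in>A. \<forall>j\<in>A. i \<noteq> j \<longrightarrow> coprime (m i) (m j)"
  shows "\<exists>x. \<forall>i\<in>A. [x = u i] (mod m i)"
  using assms
proof (induction A rule: finite_induct)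
  case (insert j A)
  then obtain y where y: "\<forall>i\<in>A. [y = u i] (mod m i)"
    by auto
  have "coprime (m j) (\<Prod>i\<in>A. m i)"
    using insert.prems insert.hyps by (intro prod_coprime_right) auto
  then obtain x where x: "[x = u j] (mod m j)" "[x = y] (mod (\<Prod>i\<in>A. m i))"
    using binary_chinese_remainder_int by blast
  have "[x = u i] (mod m i)" if "i \<in> A" for i
    using x(2) y that insert.hyps by (meson cong_dvd_modulus cong_trans dvd_prod_eqI dvd_prodI)
  with x(1) show ?case
    by blast
qed simp

lemma prod_of_bool:
  "finite A \<Longrightarrow> (\<Prod>i\<in>A. of_bool (R i)) = (of_bool (\<forall>i\<in>A. R i) :: 'a :: comm_semiring_1)"
  by (induction A rule: finite_induct) auto

lemma coprime_prime_iff: "prime q \<Longrightarrow> coprime x q \<longleftrightarrow> \<not> q dvd x" for q x :: int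
  by (metis coprime_absorb_left coprime_commute not_prime_unit prime_imp_coprime)

lemma prime_ge_5_coprime_6:
  fixes q :: int
  assumes "prime q" "q \<ge> 5"
  shows "coprime q 6"
proof -
  have "coprime q 2" "coprime q 3"
    using assms primes_coprime[of q 2] primes_coprime[of q 3] by auto
  then have "coprime q (2 * 3)"
    by (simp only: coprime_mult_right_iff)
  then show ?thesis
    by simp
qed

lemma coprime_6_iff: "coprime h 6 \<longleftrightarrow> h mod 6 = 1 \<or> h mod 6 = 5" for h :: int
proof -
  have "coprime h 6 \<longleftrightarrow> coprime h 2 \<and> coprime h 3"
    using coprime_mult_right_iff[of h 2 3] by simp
  also have "\<dots> \<longleftrightarrow> odd h \<and> \<not> 3 dvd h"
    by (simp add: coprime_prime_iff)
  also have "\<dots> \<longleftrightarrow> h mod 6 = 1 \<or> h mod 6 = 5"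
    by presburger
  finally show ?thesis .
qed

section \<open>Residue classes of z in which a prime divides H or K\<close>

lemma a_res_range:
  assumes "prime q" "q \<ge> 5"
  shows "0 \<le> a_res q" "a_res q < q"
proof -
  have "q mod 6 = 1 \<or> q mod 6 = 5"
    using prime_ge_5_coprime_6[OF assms] coprime_6_iff by simp
  then show "0 \<le> a_res q" "a_res q < q"
    using a_res_exact[OF assms] assms(2) by (auto simp: delta_eq_mod)
qed

text \<open>Since 6 is invertible modulo q, 6z + c has a single root modulo q, and \<open>a\<close>
  is its reduced representative.\<close>

lemma dvd_6_mult_iff:
  fixes q z c :: int
  assumes "prime q" "q \<ge> 5" "0 \<le> a" "a < q" "q dvd 6 * a + c"
  shows "q dvd 6 * z + c \<longleftrightarrow> z mod q = a"
proof -
  have "q dvd 6 * z + c \<longleftrightarrow> q dvd 6 * (z - a)"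
    using dvd_add_left_iff[OF assms(5), of "6 * (z - a)"] by (simp add: algebra_simps)
  also have "\<dots> \<longleftrightarrow> q dvd z - a"
    using prime_ge_5_coprime_6[OF assms(1,2)] by (rule coprime_dvd_mult_right_iff)
  also have "\<dots> \<longleftrightarrow> z mod q = a"
    using assms(3,4) by (simp add: mod_eq_dvd_iff[symmetric])
  finally show ?thesis .
qed

lemma dvd_6_plus_1_iff:
  assumes "prime q" "q \<ge> 5"
  shows "q dvd 6 * z + 1 \<longleftrightarrow> z mod q = a_res q"
proof (intro dvd_6_mult_iff)
  have "6 * a_res q + 1 = q * delta 6 q"
    using a_res_exact[OF assms] by linarith
  then show "q dvd 6 * a_res q + 1"
    by (metis dvd_triv_left)
qed (use assms a_res_range[OF assms] in auto)

text \<open>From a + b = q - 1 it follows that 6b + 5 = 6q - (6a + 1), a multiple of q.\<close>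

lemma dvd_6_plus_5_iff:
  assumes "prime q" "q \<ge> 5"
  shows "q dvd 6 * z + 5 \<longleftrightarrow> z mod q = b_res q"
proof (intro dvd_6_mult_iff)
  have "6 * b_res q + 5 = q * (6 - delta 6 q)"
    using a_res_exact[OF assms] unfolding b_res_def right_diff_distrib by linarith
  then show "q dvd 6 * b_res q + 5"
    by (metis dvd_triv_left)
qed (use assms a_res_range[OF assms] in \<open>auto simp: b_res_def\<close>)

text \<open>In \<open>K_of\<close> the variable enters as m - z; this converts its residue class
  into the one named by \<open>y_res\<close>.\<close>

lemma diff_mod_eq_iff:
  fixes q m z c :: int
  assumes "0 \<le> c" "c < q"
  shows "(m - z) mod q = c \<longleftrightarrow> z mod q = (m - c) mod q"
proof -
  have "(m - z) mod q = c \<longleftrightarrow> (m - z) mod q = c mod q"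
    using assms by simp
  also have "\<dots> \<longleftrightarrow> q dvd - (z - (m - c))"
    by (simp add: mod_eq_dvd_iff algebra_simps)
  also have "\<dots> \<longleftrightarrow> z mod q = (m - c) mod q"
    by (simp only: mod_eq_dvd_iff dvd_minus_iff)
  finally show ?thesis .
qed

lemma delta_3_cases:
  obtains "delta 3 n = 0" "n = 3 * m_of n + 3"
  | "delta 3 n = 1" "n = 3 * m_of n + 1"
  | "delta 3 n = 2" "n = 3 * m_of n + 5"
proof -
  consider "n mod 3 = 0" | "n mod 3 = 1" | "n mod 3 = 2"
    by linarith
  then show ?thesis
  proof cases
    case 1
    then obtain k where "n = 3 * k"
      by auto
    then show ?thesis
      by (intro that(1)) (simp_all add: m_of_def delta_eq_mod)
  next
    case 2
    then obtain k where "n = 3 * k + 1"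
      by (metis mult_div_mod_eq)
    then show ?thesis
      by (intro that(2)) (simp_all add: m_of_def delta_eq_mod)
  next
    case 3
    \<comment> \<open>The quotient is written as k + 1 so that n = 3k + 5 and m(n) = k.\<close>
    then obtain k where "n = 3 * (k + 1) + 2"
      by (metis diff_add_cancel mult_div_mod_eq)
    then have "n = 3 * k + 5"
      by simp
    moreover from this have "n mod 3 = 2"
      by presburger
    ultimately show ?thesis
      by (intro that(3)) (simp_all add: m_of_def delta_eq_mod)
  qed
qed

lemma H_plus_K: "H_of n z + K_of n z = 2 * n"
  by (cases rule: delta_3_cases[of n]) (simp_all add: H_of_def K_of_def)

lemma dvd_H_of_iff:
  assumes "prime q" "q \<ge> 5"
  shows "q dvd H_of n z \<longleftrightarrow> z mod q = x_res q n"
  using assms by (simp add: H_of_def x_res_def dvd_6_plus_1_iff dvd_6_plus_5_iff)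

lemma dvd_K_of_iff:
  assumes "prime q" "q \<ge> 5"
  shows "q dvd K_of n z \<longleftrightarrow> z mod q = y_res q n"
proof -
  have "0 \<le> b_res q" "b_res q < q"
    using a_res_range[OF assms] by (simp_all add: b_res_def)
  with a_res_range[OF assms] assms show ?thesis
    by (simp add: K_of_def y_res_def dvd_6_plus_1_iff dvd_6_plus_5_iff delta_eq_mod diff_mod_eq_iff
        del: right_diff_distrib_numeral)
qed

text \<open>If q divides n, the two classes coincide and the zero weight at j = 1 keeps them from
  being subtracted twice; otherwise they are disjoint.\<close>

lemma sum_w_eq_of_bool:
  assumes "prime q" "q \<ge> 5"
  shows "(\<Sum>j\<in>{0, 1, 2}. w q j n * of_bool (j \<noteq> 0 \<longrightarrow> z mod q = s_res q j n)) =
    of_bool (\<not> q dvd H_of n z * K_of n z)"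
proof -
  have "\<not> q dvd 2"
    using assms zdvd_imp_le[of q 2] by auto
  then have "q dvd n \<longleftrightarrow> q dvd H_of n z + K_of n z"
    using assms by (simp add: H_plus_K prime_dvd_mult_iff)
  then have *: "if q dvd n then q dvd H_of n z \<longleftrightarrow> q dvd K_of n z
      else \<not> (q dvd H_of n z \<and> q dvd K_of n z)"
    by (auto simp: dvd_add_right_iff dvd_add_left_iff)
  show ?thesis
    using * assms
    by (auto simp: w_def s_res_def eps_def delta_eq_mod mod_eq_0_iff_dvd prime_dvd_mult_iff
        simp flip: dvd_H_of_iff dvd_K_of_iff)
qed

section \<open>Merging the classes and expanding the product\<close>

lemma distinct_primes_coprime:
  fixes p :: "'a \<Rightarrow> int"
  assumes "\<forall>i\<in>A. prime (p i)" "inj_on p A"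
  shows "\<forall>i\<in>A. \<forall>j\<in>A. i \<noteq> j \<longrightarrow> coprime (p i) (p j)"
  using assms by (metis inj_on_contraD primes_coprime)

lemma eta_mod_eq_iff:
  assumes "\<forall>i\<in>{1..r}. prime (p i) \<and> p i \<ge> 5" "inj_on p {1..r}"
  shows "z mod Q r p \<alpha> = eta r p \<alpha> n \<longleftrightarrow>
    (\<forall>i\<in>I_set r \<alpha>. z mod p i = s_res (p i) (\<alpha> i) n)"
proof (cases "I_set r \<alpha> = {}")
  case True
  \<comment> \<open>Here Q = 1 and eta = 0, so both sides hold for every z.\<close>
  then show ?thesis
    by (simp add: Q_def eta_def)
next
  case False
  let ?I = "I_set r \<alpha>" and ?Q = "Q r p \<alpha>"
  let ?R = "\<lambda>e. \<forall>i\<in>?I. e mod p i = s_res (p i) (\<alpha> i) n"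
  have sub: "?I \<subseteq> {1..r}" and fin: "finite ?I"
    by (auto simp: I_set_def)
  have prime: "prime (p i)" "p i \<ge> 5" if "i \<in> ?I" for i
    using that sub assms(1) by auto
  have cop: "\<forall>i\<in>?I. \<forall>j\<in>?I. i \<noteq> j \<longrightarrow> coprime (p i) (p j)"
    using prime inj_on_subset[OF assms(2) sub] by (intro distinct_primes_coprime) auto
  have Qpos: "?Q > 0"
    unfolding Q_def using prime by (intro prod_pos) (force simp: prime_gt_0_int)
  have modQ: "e mod ?Q mod p i = e mod p i" if "i \<in> ?I" for e i
    using that fin by (intro mod_mod_cancel) (auto simp: Q_def)
  \<comment> \<open>The prescribed residues are already reduced, so congruences can be read as
    equations between remainders.\<close>
  have s_range: "s_res (p i) (\<alpha> i) n mod p i = s_res (p i) (\<alpha> i) n" if "i \<in> ?I" for i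
    using a_res_range[OF prime[OF that]]
    by (simp add: s_res_def x_res_def y_res_def b_res_def delta_eq_mod)
  obtain x where "\<forall>i\<in>?I. [x = s_res (p i) (\<alpha> i) n] (mod p i)"
    using chinese_remainder_int[OF fin cop, of "\<lambda>i. s_res (p i) (\<alpha> i) n"] by blast
  then have x: "?R x"
    using s_range by (simp add: cong_def)
  have uniq: "e mod ?Q = e' mod ?Q" if "?R e" "?R e'" for e e'
    using that cop unfolding Q_def cong_def[symmetric]
    by (intro cong_cong_prod_coprime) (auto simp: cong_def)
  have "eta r p \<alpha> n = (THE e. e \<in> {0..?Q - 1} \<and> ?R e)"
    using False by (simp add: eta_def delta_eq_mod)
  \<comment> \<open>Any Chinese remainder solution x, reduced modulo Q, is the described
    element.\<close>
  also have "\<dots> = x mod ?Q"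
  proof (rule the_equality)
    show "x mod ?Q \<in> {0..?Q - 1} \<and> ?R (x mod ?Q)"
      using x modQ Qpos by auto
    show "e = x mod ?Q" if "e \<in> {0..?Q - 1} \<and> ?R e" for e
      using that uniq[of e x] x by auto
  qed
  finally show ?thesis
    using x uniq modQ by metis
qed

lemma prime_coprime_prod_iff:
  fixes p :: "'a \<Rightarrow> int"
  assumes "finite A" "\<forall>i\<in>A. prime (p i)"
  shows "coprime x (\<Prod>i\<in>A. p i) \<longleftrightarrow> (\<forall>i\<in>A. \<not> p i dvd x)"
  using assms
  by (induction A rule: finite_induct) (auto simp: coprime_mult_right_iff coprime_prime_iff)

lemma C_count_eq_sum:
  assumes primes: "\<forall>i\<in>{1..r}. prime (p i) \<and> p i \<ge> 5"
    and inj: "inj_on p {1..r}"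
    and P: "P = (\<Prod>i=1..r. p i)"
  shows "int (C_count P n) =
    (\<Sum>\<alpha>\<in>{1..r} \<rightarrow>\<^sub>E {0, 1, 2}. W r p \<alpha> n * int (L (m_of n) (Q r p \<alpha>) (eta r p \<alpha> n)))"
proof -
  let ?Z = "Z_set n"
  let ?A = "{1..r} \<rightarrow>\<^sub>E {0, 1, 2 :: nat}"
  let ?hit = "\<lambda>i j z. j \<noteq> 0 \<longrightarrow> z mod p i = s_res (p i) j n"
  have Z: "?Z = {0..m_of n}"
    by (auto simp: Z_set_def)
  have "int (C_count P n) = (\<Sum>z\<in>?Z. of_bool (coprime (H_of n z * K_of n z) P))"
    by (simp add: C_count_def Z coprime_iff_gcd_eq_1 Int_def)
  also have "\<dots> = (\<Sum>z\<in>?Z. \<Prod>i=1..r. \<Sum>j\<in>{0, 1, 2}. w (p i) j n * of_bool (?hit i j z))"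
  proof (rule sum.cong[OF refl])
    fix z
    have "of_bool (coprime (H_of n z * K_of n z) P) =
        (\<Prod>i=1..r. of_bool (\<not> p i dvd H_of n z * K_of n z) :: int)"
      unfolding P using primes by (subst prime_coprime_prod_iff) (auto simp: prod_of_bool)
    also have "\<dots> = (\<Prod>i=1..r. \<Sum>j\<in>{0, 1, 2}. w (p i) j n * of_bool (?hit i j z))"
      using primes by (intro prod.cong[OF refl] sum_w_eq_of_bool[symmetric]) auto
    finally show "of_bool (coprime (H_of n z * K_of n z) P) = \<dots>" .
  qed
  \<comment> \<open>Choosing one summand j for each i amounts to choosing a function
    \<alpha>.\<close>
  also have "\<dots> = (\<Sum>z\<in>?Z. \<Sum>\<alpha>\<in>?A. \<Prod>i=1..r. w (p i) (\<alpha> i) n * of_bool (?hit i (\<alpha> i) z))"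
    by (intro sum.cong[OF refl] prod_sum_PiE) auto
  also have "\<dots> = (\<Sum>\<alpha>\<in>?A. W r p \<alpha> n * (\<Sum>z\<in>?Z. of_bool (\<forall>i\<in>{1..r}. ?hit i (\<alpha> i) z)))"
    by (subst sum.swap) (simp add: prod.distrib W_def prod_of_bool sum_distrib_left)
  also have "\<dots> = (\<Sum>\<alpha>\<in>?A. W r p \<alpha> n * int (L (m_of n) (Q r p \<alpha>) (eta r p \<alpha> n)))"
  proof (rule sum.cong[OF refl])
    fix \<alpha>
    have "(\<forall>i\<in>{1..r}. ?hit i (\<alpha> i) z) \<longleftrightarrow> z mod Q r p \<alpha> = eta r p \<alpha> n" for z
      by (auto simp: eta_mod_eq_iff[OF primes inj] I_set_def)
    then have "(\<Sum>z\<in>?Z. of_bool (\<forall>i\<in>{1..r}. ?hit i (\<alpha> i) z)) =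
        int (card {z \<in> ?Z. z mod Q r p \<alpha> = eta r p \<alpha> n})"
      by (simp add: Z Int_def)
    also have "{z \<in> ?Z. z mod Q r p \<alpha> = eta r p \<alpha> n} =
        {z. 0 \<le> z \<and> z \<le> m_of n \<and> delta (Q r p \<alpha>) z = eta r p \<alpha> n}"
      by (auto simp: Z delta_eq_mod)
    finally show "W r p \<alpha> n * (\<Sum>z\<in>?Z. of_bool (\<forall>i\<in>{1..r}. ?hit i (\<alpha> i) z)) =
        W r p \<alpha> n * int (L (m_of n) (Q r p \<alpha>) (eta r p \<alpha> n))"
      by (simp add: L_def)
  qed
  finally show ?thesis .
qed

section \<open>Reflection and the Goldbach count\<close>

definition goldbach_set :: "int \<Rightarrow> int \<Rightarrow> int set" where
  "goldbach_set P n = {h. 0 < h \<and> h < 2 * n \<and> coprime h (6 * P) \<and> coprime (2 * n - h) (6 * P)}"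

lemma finite_goldbach_set [simp]: "finite (goldbach_set P n)"
  by (rule finite_subset[of _ "{0..2 * n}"]) (auto simp: goldbach_set_def)

lemma card_goldbach_reflect:
  "card {h \<in> goldbach_set P n. R (2 * n - h)} = card {h \<in> goldbach_set P n. R h}"
  by (rule bij_betw_same_card[where f = "\<lambda>h. 2 * n - h"],
      rule bij_betwI[where g = "\<lambda>h. 2 * n - h"]) (auto simp: goldbach_set_def)

lemma double_g_count:
  assumes "n > 0"
  shows "2 * g_count P (2 * n) = card (goldbach_set P n) + D_ind P n"
proof -
  let ?S = "goldbach_set P n"
  \<comment> \<open>With k = 2n - h, the condition h \<le> k becomes h \<le> n.\<close>
  have g: "g_count P (2 * n) = card {h \<in> ?S. h \<le> n}"
    unfolding g_count_def
    by (rule bij_betw_same_card[where f = fst], rule bij_betwI[where g = "\<lambda>h. (h, 2 * n - h)"])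
      (auto simp: goldbach_set_def coprime_iff_gcd_eq_1[symmetric] eq_diff_eq[symmetric])
  have "{h \<in> ?S. 2 * n - h \<le> n} = {h \<in> ?S. h \<ge> n}"
    by auto
  then have g': "g_count P (2 * n) = card {h \<in> ?S. h \<ge> n}"
    using g card_goldbach_reflect[of P n "\<lambda>h. h \<le> n"] by simp
  have "{h \<in> ?S. h \<le> n} \<union> {h \<in> ?S. h \<ge> n} = ?S"
    by auto
  moreover have "{h \<in> ?S. h \<le> n} \<inter> {h \<in> ?S. h \<ge> n} = (if coprime n (6 * P) then {n} else {})"
    using assms by (auto simp: goldbach_set_def)
  then have "card ({h \<in> ?S. h \<le> n} \<inter> {h \<in> ?S. h \<ge> n}) = D_ind P n"
    by (simp add: D_ind_def coprime_iff_gcd_eq_1)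
  ultimately show ?thesis
    using card_Un_Int[of "{h \<in> ?S. h \<le> n}" "{h \<in> ?S. h \<ge> n}"] g g' by simp
qed

text \<open>H and K are 1 or 5 modulo 6, so coprimality to 6P reduces to coprimality to P; the
  inverse of \<open>H_of n\<close> on the class is division by 6.\<close>

lemma C_count_eq_card_goldbach:
  "C_count P n = card {h \<in> goldbach_set P n. h mod 6 = (if delta 3 n = 2 then 5 else 1)}"
proof -
  define c c' :: int where "c = (if delta 3 n = 2 then 5 else 1)"
    and "c' = (if delta 3 n = 1 then 1 else 5)"
  have c: "c = 1 \<or> c = 5" "c' = 1 \<or> c' = 5"
    by (simp_all add: c_def c'_def)
  have H: "H_of n z = 6 * z + c" and K: "K_of n z = 6 * (m_of n - z) + c'" for z
    by (cases rule: delta_3_cases[of n]; simp add: H_of_def K_of_def c_def c'_def)+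
  have K': "2 * n - H_of n z = K_of n z" for z
    using H_plus_K[of n z] by simp
  have cop: "coprime (H_of n z * K_of n z) P \<longleftrightarrow>
      coprime (H_of n z) (6 * P) \<and> coprime (K_of n z) (6 * P)" for z
    using c by (auto simp: H K coprime_mult_left_iff coprime_mult_right_iff coprime_6_iff
        simp del: right_diff_distrib_numeral)
  have "C_count P n = card {h \<in> goldbach_set P n. h mod 6 = c}"
    unfolding C_count_def
  proof (rule bij_betw_same_card[where f = "H_of n"], rule bij_betwI[where g = "\<lambda>h. h div 6"])
    show "H_of n \<in> {z \<in> Z_set n. gcd (H_of n z * K_of n z) P = 1} \<rightarrow>
        {h \<in> goldbach_set P n. h mod 6 = c}"
    proof (intro funcsetI)
      fix z assume "z \<in> {z \<in> Z_set n. gcd (H_of n z * K_of n z) P = 1}"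
      then have z: "0 \<le> z" "z \<le> m_of n" "coprime (H_of n z * K_of n z) P"
        by (auto simp: Z_set_def coprime_iff_gcd_eq_1)
      then have "H_of n z > 0" "K_of n z > 0" "H_of n z mod 6 = c"
        using c by (auto simp: H K)
      with z(3) show "H_of n z \<in> {h \<in> goldbach_set P n. h mod 6 = c}"
        unfolding cop using H_plus_K[of n z]
        by (simp add: goldbach_set_def K' del: coprime_mult_right_iff)
    qed
    \<comment> \<open>Replacing \<open>c\<close> by \<open>h mod 6\<close> turns this into division
      with remainder.\<close>
    have HH: "H_of n (h div 6) = h" if "h mod 6 = c" for h
      using that by (simp add: H flip: that)
    show "(\<lambda>h. h div 6) \<in> {h \<in> goldbach_set P n. h mod 6 = c} \<rightarrow>
        {z \<in> Z_set n. gcd (H_of n z * K_of n z) P = 1}"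
    proof (intro funcsetI)
      fix h assume h: "h \<in> {h \<in> goldbach_set P n. h mod 6 = c}"
      let ?z = "h div 6"
      have Hz: "H_of n ?z = h" and Kz: "K_of n ?z = 2 * n - h"
        using h HH K'[of ?z] by auto
      have "coprime (H_of n ?z * K_of n ?z) P"
        using h unfolding cop unfolding Hz Kz by (simp add: goldbach_set_def)
      moreover have "0 \<le> ?z"
        using h by (simp add: goldbach_set_def pos_imp_zdiv_nonneg_iff)
      moreover have "K_of n ?z > 0"
        using h unfolding Kz by (simp add: goldbach_set_def)
      \<comment> \<open>As c' < 6, positivity of 6(m - z) + c' forces m - z \<ge> 0.\<close>
      then have "?z \<le> m_of n"
        using c(2) unfolding K by (elim disjE; simp)
      ultimately show "?z \<in> {z \<in> Z_set n. gcd (H_of n z * K_of n z) P = 1}"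
        by (simp add: Z_set_def coprime_iff_gcd_eq_1)
    qed
    show "H_of n z div 6 = z" for z
      using c by (auto simp: H)
    show "H_of n (h div 6) = h" if "h \<in> {h \<in> goldbach_set P n. h mod 6 = c}" for h
      using that HH by simp
  qed
  then show ?thesis
    by (simp add: c_def)
qed

lemma goldbach_set_mod_6:
  assumes "h \<in> goldbach_set P n"
  shows "h mod 6 = 1 \<or> h mod 6 = 5" "(2 * n - h) mod 6 = 1 \<or> (2 * n - h) mod 6 = 5"
  using assms by (auto simp: goldbach_set_def coprime_mult_right_iff coprime_6_iff)

lemma card_goldbach_set:
  "card (goldbach_set P n) = (if delta 3 n = 0 then 2 * C_count P n else C_count P n)"
proof -
  let ?S = "goldbach_set P n"
  note mod6 = goldbach_set_mod_6[of _ P n]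
  show ?thesis
  proof (cases rule: delta_3_cases[of n])
    case 1
    \<comment> \<open>Now 2n is 0 modulo 6, so reflection negates residues.\<close>
    have "{h \<in> ?S. (2 * n - h) mod 6 = 1} = {h \<in> ?S. h mod 6 = 5}"
    proof (intro Collect_cong conj_cong refl)
      fix h assume "h \<in> ?S"
      from mod6[OF this] 1(2) show "(2 * n - h) mod 6 = 1 \<longleftrightarrow> h mod 6 = 5"
        by presburger
    qed
    then have "card {h \<in> ?S. h mod 6 = 5} = card {h \<in> ?S. h mod 6 = 1}"
      using card_goldbach_reflect[of P n "\<lambda>h. h mod 6 = 1"] by simp
    moreover have "?S = {h \<in> ?S. h mod 6 = 1} \<union> {h \<in> ?S. h mod 6 = 5}"
      using mod6 by blast
    then have "card ?S = card {h \<in> ?S. h mod 6 = 1} + card {h \<in> ?S. h mod 6 = 5}"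
      using card_Un_disjoint[of "{h \<in> ?S. h mod 6 = 1}" "{h \<in> ?S. h mod 6 = 5}"] by fastforce
    ultimately show ?thesis
      using 1(1) by (simp add: C_count_eq_card_goldbach)
  next
    case 2
    \<comment> \<open>Now 2n is 2 modulo 6; residue 5 for h would give 2n - h residue 3.\<close>
    have "h mod 6 = 1" if "h \<in> ?S" for h
      using mod6[OF that] 2(2) by presburger
    then have "{h \<in> ?S. h mod 6 = 1} = ?S"
      by blast
    then show ?thesis
      using 2(1) by (simp add: C_count_eq_card_goldbach)
  next
    case 3
    \<comment> \<open>Now 2n is 4 modulo 6; residue 1 for h would give 2n - h residue 3.\<close>
    have "h mod 6 = 5" if "h \<in> ?S" for h
      using mod6[OF that] 3(2) by presburger
    then have "{h \<in> ?S. h mod 6 = 5} = ?S"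
      by blast
    then show ?thesis
      using 3(1) by (simp add: C_count_eq_card_goldbach)
  qed
qed

text \<open>The common factor 3 of n and 6P rules out the fixed point, so that twice the Goldbach
  count is exactly twice \<open>C_count\<close>.\<close>

lemma D_ind_eq_0:
  assumes "delta 3 n = 0"
  shows "D_ind P n = 0"
proof -
  have "3 dvd gcd n (6 * P)"
    using assms by (auto simp: delta_eq_mod)
  then have "gcd n (6 * P) \<noteq> 1"
    by (rule contrapos_pn) (simp only:, simp)
  then show ?thesis
    unfolding D_ind_def by (simp only: of_bool_eq)
qed

theorem theorem3p3:
  fixes r :: nat and p :: "nat \<Rightarrow> int" and P n :: int
  assumes "r \<ge> 1"
    and "\<forall>i\<in>{1..r}. prime (p i) \<and> p i \<ge> 5"
    and "inj_on p {1..r}"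
    and "P = (\<Prod>i=1..r. p i)"
    and "n > 0"
  shows "int (C_count P n) =
           (\<Sum>\<alpha>\<in>{1..r} \<rightarrow>\<^sub>E {0, 1, 2}. W r p \<alpha> n * int (L (m_of n) (Q r p \<alpha>) (eta r p \<alpha> n)))
       \<and> real (g_count P (2 * n)) =
           (if delta 3 n = 0 then real (C_count P n)
            else (real (C_count P n) + real (D_ind P n)) / 2)"
proof
  show "int (C_count P n) =
      (\<Sum>\<alpha>\<in>{1..r} \<rightarrow>\<^sub>E {0, 1, 2}. W r p \<alpha> n * int (L (m_of n) (Q r p \<alpha>) (eta r p \<alpha> n)))"
    using assms by (intro C_count_eq_sum)
  show "real (g_count P (2 * n)) =
      (if delta 3 n = 0 then real (C_count P n)
       else (real (C_count P n) + real (D_ind P n)) / 2)"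
    using double_g_count[OF assms(5), of P] D_ind_eq_0[of n P]
    by (auto simp: card_goldbach_set split: if_splits)
qed

end
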